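(* $\Delta_4(n) \le \dfrac{2}{n} + o\!\left(\dfrac{1}{n}\right)$ as $n\to\infty$; that is, $\limsup_{n\to\infty} n\,\Delta_4(n) \le 2$.
   Context: For an integer $k\ge 3$, an integer $n\ge k$ and a set $\mathcal{P}$ of $n$ points in the unit square $[0,1]^2$, let $\mathcal{A}_k(\mathcal{P})$ be the minimum, over all $k$-element subsets of $\mathcal{P}$, of the area of the convex hull of that subset. Define $\Delta_k(n)$ as the supremum of $\mathcal{A}_k(\mathcal{P})$ over all $n$-point sets $\mathcal{P}\subset[0,1]^2$. *)

theory Defs
  imports "HOL-Analysis.Analysis" "HOL-Library.Landau_Symbols"
begin

definition unit_square :: "(real^2) set" where
  "unit_square = cbox 0 1"

(* Intended for finite P with at least k points, so that Min ranges over a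
   finite nonempty set. *)
definition min_hull_area :: "nat \<Rightarrow> (real^2) set \<Rightarrow> real" where
  "min_hull_area k P =
     Min ((\<lambda>Q. measure lebesgue (convex hull Q)) ` {Q. Q \<subseteq> P \<and> card Q = k})"

(* Intended for 1 <= k <= n: the supremum is then over a nonempty set of reals
   contained in [0, 1], so the real-valued Sup is the true supremum. *)
definition Delta :: "nat \<Rightarrow> nat \<Rightarrow> real" where
  "Delta k n =
     (SUP P \<in> {P. P \<subseteq> unit_square \<and> finite P \<and> card P = n}. min_hull_area k P)"

end

theory Submission
  imports Defs "HOL-Real_Asymp.Real_Asymp"
begin

text \<open>
  List the points by increasing abscissa, with abscissae \<open>X 0 \<le> X 1 \<le> \<dots>\<close>. The vertical sections of the
  hull of four consecutive points \<open>a, b, c, d\<close> have length at most one, and this length decays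
  linearly to zero from \<open>b\<close> towards \<open>a\<close> and from \<open>c\<close> towards \<open>d\<close>. So the hull is covered by two
  triangles and a rectangle, of total area half of \<open>X (i + 3) - X i + X (i + 2) - X (i + 1)\<close>.
  Summed over the \<open>n - 3\<close> consecutive quadruples this telescopes to at most \<open>2\<close>.
\<close>

lemma mem_unit_square_iff: "p \<in> unit_square \<longleftrightarrow> 0 \<le> p$1 \<and> p$1 \<le> 1 \<and> 0 \<le> p$2 \<and> p$2 \<le> 1"
  by (auto simp: unit_square_def mem_box_cart forall_2)

lemma convex_unit_square: "convex unit_square"
  by (simp add: unit_square_def)

text \<open>The side opposite \<open>a\<close> is the full chord of the unit square at abscissa
  \<open>\<beta>\<close>, so it contains any section there of a subset of the square. If
  \<open>a$1 = \<beta>\<close> the triangle is degenerate, which is harmless.\<close>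

abbreviation vertical_triangle :: "real^2 \<Rightarrow> real \<Rightarrow> (real^2) set" where
  "vertical_triangle a \<beta> \<equiv> convex hull {a, vector [\<beta>, 0], vector [\<beta>, 1]}"

lemma vertical_segment_mem_hull:
  fixes q :: "real^2"
  assumes "q \<in> unit_square"
  shows "q \<in> convex hull {vector [q$1, 0], vector [q$1, 1]}"
proof -
  have "q = (1 - q$2) *\<^sub>R vector [q$1, 0] + q$2 *\<^sub>R vector [q$1, 1]"
    by (simp add: vec_eq_iff forall_2 algebra_simps)
  then show ?thesis
    using assms unfolding segment_convex_hull[symmetric] in_segment mem_unit_square_iff by blast
qed

text \<open>On the way from \<open>a\<close> through \<open>p\<close> to \<open>r\<close>, the
  stretch after \<open>p\<close> meets the line at abscissa \<open>\<beta>\<close> in a point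
  \<open>q\<close> of the chord. Since \<open>p\<close> lies between \<open>a\<close> and
  \<open>q\<close>, convexity of the triangle finishes.\<close>

lemma segment_mem_vertical_triangle:
  assumes "a \<in> unit_square" "r \<in> unit_square" "p \<in> closed_segment a r"
    and \<beta>: "\<beta> \<in> closed_segment (p$1) (r$1)"
  shows "p \<in> vertical_triangle a \<beta>"
proof -
  obtain s where s: "0 \<le> s" "s \<le> 1" "\<beta> = (1 - s) * p$1 + s * r$1"
    using \<beta> by (auto simp: in_segment)
  define q where "q = (1 - s) *\<^sub>R p + s *\<^sub>R r"
  have q1: "q$1 = \<beta>" by (simp add: q_def s)
  have qpr: "q \<in> closed_segment p r" using s by (auto simp: q_def in_segment)
  have ar: "closed_segment a r \<subseteq> unit_square"
    using assms closed_segment_subset convex_unit_square by blast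
  have "q \<in> closed_segment a r"
    using qpr assms(3) by (meson closed_segment_subset convex_closed_segment ends_in_segment(2) subsetD)
  then have "q \<in> convex hull {vector [\<beta>, 0], vector [\<beta>, 1]}"
    using vertical_segment_mem_hull[of q] ar q1 by auto
  then have "q \<in> vertical_triangle a \<beta>"
    by (meson hull_mono subset_insertI subsetD)
  moreover have "a \<in> vertical_triangle a \<beta>" by (simp add: hull_inc)
  moreover have "p \<in> closed_segment a q"
  proof -
    have "between (r, a) p" "between (p, r) q"
      using assms(3) qpr by (auto simp: between_mem_segment closed_segment_commute)
    then show ?thesis
      using between_trans_2 between_mem_segment by blast
  qed
  ultimately show ?thesis
    by (meson closed_segment_subset convex_convex_hull subsetD)
qed

text \<open>A point of the hull lies on a segment from \<open>a\<close> to some \<open>r\<close> in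
  the hull of \<open>S\<close>. The hypothesis \<open>sep\<close> lets the vertical line at
  \<open>\<beta>\<close> weakly separate \<open>p\<close> from every such \<open>r\<close>,
  whichever side \<open>a\<close> is on.\<close>

lemma hull_mem_vertical_triangle:
  assumes "insert a S \<subseteq> unit_square" "S \<noteq> {}" "p \<in> convex hull (insert a S)"
    and sep: "\<And>r. r \<in> convex hull S \<Longrightarrow> \<beta> \<in> closed_segment (p$1) (r$1)"
  shows "p \<in> vertical_triangle a \<beta>"
proof -
  obtain r where r: "r \<in> convex hull S" "p \<in> closed_segment a r"
    using assms(2,3) by (auto simp: convex_hull_insert_segments)
  moreover have "convex hull S \<subseteq> unit_square"
    using assms(1) convex_unit_square by (simp add: hull_minimal)
  ultimately show ?thesis
    using segment_mem_vertical_triangle[of a r p \<beta>] sep[OF r(1)] assms(1) by auto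
qed

lemma measure_vertical_triangle:
  "measure lebesgue (vertical_triangle a \<beta>) = \<bar>\<beta> - a$1\<bar> / 2"
proof -
  \<comment> \<open>On Borel sets \<open>lebesgue\<close> agrees with \<open>lborel\<close>, the
    measure in \<open>content_triangle\<close>.\<close>
  have "vertical_triangle a \<beta> \<in> sets lborel"
    by (simp add: compact_imp_closed compact_convex_hull finite_imp_compact)
  then show ?thesis
    by (simp add: content_triangle algebra_simps)
qed

lemma convex_hull_coord_ge:
  fixes S :: "(real^'n) set"
  assumes "\<And>x. x \<in> S \<Longrightarrow> \<beta> \<le> x$i" "p \<in> convex hull S"
  shows "\<beta> \<le> p$i"
proof -
  have "convex {x::real^'n. \<beta> \<le> x$i}"
    using convex_halfspace_ge[of \<beta> "axis i (1::real)"] by (simp add: inner_axis')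
  then have "convex hull S \<subseteq> {x. \<beta> \<le> x$i}"
    using assms(1) by (intro hull_minimal) auto
  then show ?thesis using assms(2) by auto
qed

lemma convex_hull_coord_le:
  fixes S :: "(real^'n) set"
  assumes "\<And>x. x \<in> S \<Longrightarrow> x$i \<le> \<beta>" "p \<in> convex hull S"
  shows "p$i \<le> \<beta>"
proof -
  have "convex {x::real^'n. x$i \<le> \<beta>}"
    using convex_halfspace_le[of "axis i (1::real)" \<beta>] by (simp add: inner_axis')
  then have "convex hull S \<subseteq> {x. x$i \<le> \<beta>}"
    using assms(1) by (intro hull_minimal) auto
  then show ?thesis using assms(2) by auto
qed

text \<open>The triangles contribute \<open>(b$1 - a$1) / 2\<close> and
  \<open>(d$1 - c$1) / 2\<close>, the middle rectangle of height one contributes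
  \<open>c$1 - b$1\<close>.\<close>

lemma measure_hull_four_le:
  assumes sq: "{a, b, c, d} \<subseteq> unit_square"
    and ord: "a$1 \<le> b$1" "b$1 \<le> c$1" "c$1 \<le> d$1"
  shows "measure lebesgue (convex hull {a, b, c, d}) \<le> (d$1 - a$1 + (c$1 - b$1)) / 2"
proof -
  define R :: "(real^2) set" where "R = cbox (vector [b$1, 0]) (vector [c$1, 1])"
  let ?T1 = "vertical_triangle a (b$1)" and ?T2 = "vertical_triangle d (c$1)"
  have "p \<in> ?T1 \<union> R \<union> ?T2" if p: "p \<in> convex hull {a, b, c, d}" for p
  proof -
    have psq: "p \<in> unit_square"
      using p hull_minimal[where S = convex, OF sq convex_unit_square] by (rule subsetD[rotated])
    consider "p$1 \<le> b$1" | "b$1 \<le> p$1" "p$1 \<le> c$1" | "c$1 \<le> p$1" by linarith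
    then show ?thesis
    proof cases
      case 1
      have "p \<in> ?T1"
      proof (rule hull_mem_vertical_triangle[of a "{b, c, d}"])
        fix r assume "r \<in> convex hull {b, c, d}"
        then have "b$1 \<le> r$1" using ord by (elim convex_hull_coord_ge[rotated]) auto
        then show "b$1 \<in> closed_segment (p$1) (r$1)" using 1 by (simp add: closed_segment_eq_real_ivl)
      qed (use p sq in simp_all)
      then show ?thesis by blast
    next
      case 2
      then show ?thesis using psq by (auto simp: R_def mem_box_cart forall_2 mem_unit_square_iff)
    next
      case 3
      have "p \<in> ?T2"
      proof (rule hull_mem_vertical_triangle[of d "{a, b, c}"])
        fix r assume "r \<in> convex hull {a, b, c}"
        then have "r$1 \<le> c$1" using ord by (elim convex_hull_coord_le[rotated]) auto
        then show "c$1 \<in> closed_segment (p$1) (r$1)" using 3 by (simp add: closed_segment_eq_real_ivl)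
      qed (use p sq in \<open>simp_all add: insert_commute\<close>)
      then show ?thesis by blast
    qed
  qed
  then have sub: "convex hull {a, b, c, d} \<subseteq> ?T1 \<union> R \<union> ?T2" by blast
  have lm: "convex hull {a, b, c, d} \<in> lmeasurable" "?T1 \<in> lmeasurable" "?T2 \<in> lmeasurable" "R \<in> lmeasurable"
    by (auto simp: R_def intro!: lmeasurable_compact finite_imp_compact_convex_hull)
  have "measure lebesgue (convex hull {a, b, c, d}) \<le> measure lebesgue (?T1 \<union> R \<union> ?T2)"
    using lm sub by (intro measure_mono_fmeasurable) (auto simp: fmeasurableD)
  also have "\<dots> \<le> measure lebesgue ?T1 + measure lebesgue R + measure lebesgue ?T2"
    using lm by (meson add_right_mono fmeasurable.Un fmeasurableD measure_Un_le order_trans)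
  also have "measure lebesgue R = c$1 - b$1"
  proof -
    have "R \<noteq> {}" using ord by (simp add: R_def interval_ne_empty_cart forall_2)
    then show ?thesis by (simp add: R_def content_cbox_cart UNIV_2)
  qed
  finally show ?thesis using ord by (simp add: measure_vertical_triangle field_simps)
qed

text \<open>Differences at distance three leave three terms at each end; those at distance one leave
  \<open>X (m + 1) - X 1\<close>, which doubles the middle terms.\<close>

lemma sum_diff_shift3:
  fixes X :: "nat \<Rightarrow> real"
  shows "(\<Sum>i<m. X (i + 3) - X i + (X (i + 2) - X (i + 1)))
    = X m + 2 * X (m + 1) + X (m + 2) - (X 0 + 2 * X 1 + X 2)"
  by (induction m) (auto simp: numeral_eq_Suc)

text \<open>The minimum is at most the average over the \<open>m = n - 3\<close> windows of four
  consecutive points.\<close>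

lemma min_hull_area_four_le:
  assumes P: "P \<subseteq> unit_square" "finite P" "card P = n" and n: "n \<ge> 4"
  shows "min_hull_area 4 P \<le> 2 / (real n - 3)"
proof -
  obtain m where m: "n = m + 3"
    using le_Suc_ex[of 3 n] n by auto
  obtain ys where ys: "set ys = P" "distinct ys" "sorted (map (\<lambda>p. p$1) ys)"
    by (metis P(2) distinct_sort finite_distinct_list set_sort sorted_sort_key)
  have len: "length ys = n" using ys P distinct_card by fastforce
  define X where "X i = (ys ! i)$1" for i
  have mem: "ys ! i \<in> P" if "i < n" for i using that ys len by auto
  have Xm: "X i \<le> X j" if "i \<le> j" "j < n" for i j
    using that sorted_nth_mono[OF ys(3), of i j] len by (simp add: X_def)
  have X01: "0 \<le> X i" "X i \<le> 1" if "i < n" for i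
    using mem[OF that] P(1) by (auto simp: X_def mem_unit_square_iff subset_iff)
  have step: "min_hull_area 4 P \<le> (X (i + 3) - X i + (X (i + 2) - X (i + 1))) / 2" if "i < m" for i
  proof -
    let ?Q = "{ys ! i, ys ! (i + 1), ys ! (i + 2), ys ! (i + 3)}"
    have QP: "?Q \<subseteq> P" using mem that m by auto
    \<comment> \<open>Distinctness comes from the list, not from the abscissae, which may
      coincide.\<close>
    have "card ?Q = 4"
      using that m ys(2) len by (simp add: nth_eq_iff_index_eq)
    then have "min_hull_area 4 P \<le> measure lebesgue (convex hull ?Q)"
      unfolding min_hull_area_def using P(2) QP by (intro Min_le) auto
    also have "\<dots> \<le> ((ys ! (i + 3))$1 - (ys ! i)$1 + ((ys ! (i + 2))$1 - (ys ! (i + 1))$1)) / 2"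
      using Xm[unfolded X_def] that m QP P(1) by (intro measure_hull_four_le) auto
    finally show ?thesis by (simp add: X_def)
  qed
  have lt: "m < n" "m + 1 < n" "m + 2 < n" "0 < n" "1 < n" "2 < n"
    using n m by auto
  have "real m * min_hull_area 4 P = (\<Sum>i<m. min_hull_area 4 P)" by simp
  also have "\<dots> \<le> (\<Sum>i<m. (X (i + 3) - X i + (X (i + 2) - X (i + 1))) / 2)"
    using step by (intro sum_mono) auto
  also have "\<dots> = (X m + 2 * X (m + 1) + X (m + 2) - (X 0 + 2 * X 1 + X 2)) / 2"
    by (simp only: sum_divide_distrib[symmetric] sum_diff_shift3)
  \<comment> \<open>The positive terms have total weight four and values at most one; the subtracted
    ones are nonnegative.\<close>
  also have "\<dots> \<le> 2"
    using lt[THEN X01(1)] lt[THEN X01(2)] by simp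
  finally show ?thesis using n m by (simp add: field_simps)
qed

text \<open>This provides \<open>n\<close>-point configurations for every \<open>n\<close>, so that
  the supremum in \<open>Delta\<close> is over a nonempty set.\<close>

lemma infinite_unit_square: "infinite unit_square"
proof
  assume "finite unit_square"
  moreover have "(\<lambda>t. vector [t, 0] :: real^2) ` {0..1} \<subseteq> unit_square"
    by (auto simp: mem_unit_square_iff)
  moreover have "inj_on (\<lambda>t. vector [t, 0] :: real^2) {0..1}"
    by (rule inj_on_inverseI[where g = "\<lambda>p. p$1"]) simp
  ultimately have "finite {0..1::real}"
    using inj_on_finite by blast
  then show False
    by (simp add: infinite_Icc)
qed

lemma Delta_four_le:
  assumes "n \<ge> 4"
  shows "Delta 4 n \<le> 2 / (real n - 3)"
proof -
  have "\<exists>P. P \<subseteq> unit_square \<and> finite P \<and> card P = n"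
    using infinite_arbitrarily_large[OF infinite_unit_square] by blast
  then show ?thesis
    unfolding Delta_def using min_hull_area_four_le assms by (intro cSUP_least) auto
qed

theorem theorem1:
  shows "(\<exists>e :: nat \<Rightarrow> real. e \<in> o(\<lambda>n. 1 / real n) \<and>
            (\<forall>n\<ge>4. Delta 4 n \<le> 2 / real n + e n)) \<and>
         limsup (\<lambda>n. ereal (real n * Delta 4 n)) \<le> 2"
proof (intro conjI exI)
  \<comment> \<open>The witness is the exact excess of the bound over \<open>2 / n\<close>, namely
    \<open>6 / (n * (n - 3))\<close> for \<open>n \<ge> 4\<close>.\<close>
  show "(\<lambda>n. 2 / (real n - 3) - 2 / real n) \<in> o(\<lambda>n. 1 / real n)" by real_asymp
  show "\<forall>n\<ge>4. Delta 4 n \<le> 2 / real n + (2 / (real n - 3) - 2 / real n)"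
    using Delta_four_le by simp
  have "(\<lambda>n. real n * (2 / (real n - 3))) \<longlonglongrightarrow> 2" by real_asymp
  then have "(\<lambda>n. ereal (real n * (2 / (real n - 3)))) \<longlonglongrightarrow> ereal 2" by simp
  then have "limsup (\<lambda>n. ereal (real n * (2 / (real n - 3)))) = 2"
    using lim_imp_Limsup by force
  moreover have "limsup (\<lambda>n. ereal (real n * Delta 4 n)) \<le> limsup (\<lambda>n. ereal (real n * (2 / (real n - 3))))"
    using Delta_four_le
    by (intro Limsup_mono) (auto intro!: mult_left_mono eventually_sequentiallyI[of 4] simp del: times_divide_eq_right)
  ultimately show "limsup (\<lambda>n. ereal (real n * Delta 4 n)) \<le> 2" by simp
qed

end
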